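(* For $n\ge0$ let $S_n$ be the number of subsets of $\{1,\ldots,n\}$ such that no two elements of the subset differ by an element of $\{1,4\}$. Then, as formal power series, $$\sum_{n\ge0}S_nx^n=\frac{1+x+x^2+x^3+2x^4+x^6}{1-x-x^3+x^4-2x^5+x^6-x^7}.$$
   Context: The empty subset is counted, and for $n=0$ the set $\{1,\ldots,n\}$ is empty, so $S_0=1$. *)

theory Defs
  imports "HOL-Computational_Algebra.Formal_Power_Series"
begin

(* The distance is taken in int because subtraction on nat truncates at 0. *)
definition avoids_differences :: "nat set \<Rightarrow> nat set \<Rightarrow> bool" where
  "avoids_differences D A \<longleftrightarrow> (\<forall>a\<in>A. \<forall>b\<in>A. \<bar>int a - int b\<bar> \<notin> int ` D)"

definition S :: "nat \<Rightarrow> nat" where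
  "S n = card {A. A \<subseteq> {1..n} \<and> avoids_differences {1, 4} A}"

end

theory Submission
  imports Defs
begin

text \<open>
  Scan the possible elements downwards from \<open>n\<close>. Putting \<open>n\<close> into the subset forbids
  \<open>n - 1\<close> and \<open>n - 4\<close>, so the natural quantity is the number of admissible subsets of
  \<open>{1..n}\<close> that miss a prescribed set \<open>B\<close> of forbidden positions. It satisfies a one-step
  recurrence (\<open>count_missing_Suc\<close>) in which only finitely many shapes of \<open>B\<close>, relative
  to \<open>n\<close>, are reachable from \<open>B = {}\<close>: a transfer-matrix argument. Whenever \<open>n\<close> itself is forbidden the shape has a
  single successor; substituting these steps, and the one for \<open>B = {n - 1}\<close>, leaves two
  sequences, \<open>a n\<close> for \<open>B = {}\<close> and \<open>d n\<close> for \<open>B = {n - 2}\<close>, with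
    \<open>a (n + 2) = a (n + 1) + d n\<close> and
    \<open>d (n + 5) = a (n + 2) + d (n + 2) + a n + d n\<close>.
  Their generating functions \<open>A\<close> and \<open>D\<close> therefore satisfy the linear system
    \<open>(1 - x) A = 1 + x + x^2 D\<close> and
    \<open>(1 - x^3 - x^5) D = 1 + 2x + 3x^2 + x^3 + 2x^4 + (x^3 + x^5) A\<close>,
  and the denominator of the theorem is its determinant
  \<open>(1 - x) (1 - x^3 - x^5) - x^2 (x^3 + x^5)\<close>.
\<close>

section \<open>Admissible subsets missing a set of forbidden positions\<close>

text \<open>
  Positions outside \<open>{1..n}\<close> in \<open>B\<close> have no effect. In particular a forbidden position
  \<open>n - k\<close> with \<open>n \<le> k\<close>, which truncated subtraction turns into \<open>0\<close>, is harmless; this lets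
  the recurrences below hold without lower bounds on \<open>n\<close>.
\<close>

definition count_missing :: "nat \<Rightarrow> nat set \<Rightarrow> nat" where
  "count_missing n B = card {A. A \<subseteq> {1..n} - B \<and> avoids_differences {1, 4} A}"

lemma S_eq_count_missing: "S n = count_missing n {}"
  by (simp add: S_def count_missing_def)

lemma count_missing_0 [simp]: "count_missing 0 B = 1"
proof -
  have "{A. A \<subseteq> {1..0} - B \<and> avoids_differences {1, 4} A} = {{}}"
    by (auto simp: avoids_differences_def)
  then show ?thesis
    by (simp add: count_missing_def)
qed

lemma count_missing_insert_0 [simp]: "count_missing n (insert 0 B) = count_missing n B"
proof -
  have "{1..n} - insert 0 B = {1..n} - B" by auto
  then show ?thesis by (simp add: count_missing_def)
qed

lemma count_missing_insert_Suc [simp]: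
  "count_missing (Suc n) (insert (Suc n) B) = count_missing n B"
proof -
  have "{1..Suc n} - insert (Suc n) B = {1..n} - B" by auto
  then show ?thesis by (simp add: count_missing_def)
qed

lemma avoids_differences_insert_Suc:
  assumes "A \<subseteq> {1..n}"
  shows "avoids_differences {1, 4} (insert (Suc n) A) \<longleftrightarrow>
    avoids_differences {1, 4} A \<and> n \<notin> A \<and> n - 3 \<notin> A"
proof -
  have pos: "0 \<notin> A"
    using assms by auto
  have gap: "\<bar>int (Suc n) - int b\<bar> \<in> int ` {1, 4} \<longleftrightarrow> b = n \<or> b = n - 3" if "b \<in> A" for b
  proof -
    have "1 \<le> b" "b \<le> n" using assms that by auto
    then show ?thesis by auto
  qed
  have gap': "\<bar>int b - int (Suc n)\<bar> \<in> int ` {1, 4} \<longleftrightarrow> b = n \<or> b = n - 3" if "b \<in> A" for b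
    using gap[OF that] by (simp only: abs_minus_commute)
  have refl: "\<bar>int (Suc n) - int (Suc n)\<bar> \<notin> int ` {1, 4}"
    by simp
  show ?thesis
    unfolding avoids_differences_def using gap gap' refl by blast
qed

text \<open>The two summands count the subsets without and with the largest position \<open>n + 1\<close>.\<close>

lemma count_missing_Suc:
  assumes "Suc n \<notin> B"
  shows "count_missing (Suc n) B = count_missing n B + count_missing n (B \<union> {n, n - 3})"
proof -
  let ?adm = "\<lambda>n B. {A. A \<subseteq> {1..n} - B \<and> avoids_differences {1, 4} A}"
  let ?with = "insert (Suc n) ` ?adm n (B \<union> {n, n - 3})"
  have split: "?adm (Suc n) B = ?adm n B \<union> ?with"
  proof (intro equalityI subsetI)
    fix A assume A: "A \<in> ?adm (Suc n) B"
    show "A \<in> ?adm n B \<union> ?with"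
    proof (cases "Suc n \<in> A")
      case False
      then have "A \<subseteq> {1..n} - B"
        using A by (auto simp: le_Suc_eq)
      then show ?thesis
        using A by simp
    next
      case True
      define A' where "A' = A - {Suc n}"
      have ins: "A = insert (Suc n) A'"
        using True by (auto simp: A'_def)
      have sub: "A' \<subseteq> {1..n} - B"
        using A by (auto simp: A'_def le_Suc_eq)
      then have "avoids_differences {1, 4} A' \<and> n \<notin> A' \<and> n - 3 \<notin> A'"
        using A avoids_differences_insert_Suc[of A' n] by (auto simp: ins)
      then have "A' \<in> ?adm n (B \<union> {n, n - 3})"
        using sub by auto
      then show ?thesis
        using ins by blast
    qed
  next
    fix A assume "A \<in> ?adm n B \<union> ?with"
    then show "A \<in> ?adm (Suc n) B"
    proof
      assume "A \<in> ?adm n B"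
      then show ?thesis by fastforce
    next
      assume "A \<in> ?with"
      then obtain A' where ins: "A = insert (Suc n) A'"
        and A': "A' \<subseteq> {1..n} - (B \<union> {n, n - 3})" "avoids_differences {1, 4} A'"
        by auto
      then have "avoids_differences {1, 4} A"
        using avoids_differences_insert_Suc[of A' n] by auto
      moreover have "A \<subseteq> {1..Suc n} - B"
        using ins A' assms by fastforce
      ultimately show ?thesis by simp
    qed
  qed
  have fin: "finite (?adm n C)" for C
    by (rule finite_subset[of _ "Pow {1..n}"]) auto
  have "?adm n B \<inter> ?with = {}"
    by auto
  moreover have "inj_on (insert (Suc n)) (?adm n (B \<union> {n, n - 3}))"
  proof (rule inj_onI)
    fix A A' assume "A \<in> ?adm n (B \<union> {n, n - 3})" "A' \<in> ?adm n (B \<union> {n, n - 3})"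
      and eq: "insert (Suc n) A = insert (Suc n) A'"
    then have "Suc n \<notin> A" "Suc n \<notin> A'" by auto
    then show "A = A'" using eq by (simp add: insert_ident)
  qed
  ultimately show ?thesis
    unfolding count_missing_def split using fin
    by (simp add: card_Un_disjoint card_image)
qed

section \<open>Two coupled recurrences\<close>

lemma S_Suc_Suc: "S (Suc (Suc n)) = S (Suc n) + count_missing n {n - 2}"
  by (simp add: S_eq_count_missing count_missing_Suc[of "Suc n"])

text \<open>
  From \<open>B = {n - 2}\<close> the scan always reaches the shape \<open>{n - 1}\<close>, after one step if \<open>n\<close> is
  left out and after three if it is taken; from there it returns to \<open>{}\<close> or \<open>{n - 2}\<close>
  after two more steps.
\<close>

lemma count_missing_second_last:
  "count_missing (Suc (Suc n)) {Suc n} = S n + count_missing n {n - 2}"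
proof -
  have "count_missing (Suc (Suc n)) {Suc n} =
      count_missing (Suc n) {Suc n} + count_missing (Suc n) {Suc n, n - 2}"
    by (simp add: count_missing_Suc[of "Suc n"] insert_commute)
  then show ?thesis
    by (simp add: S_eq_count_missing)
qed

lemma count_missing_third_last:
  "count_missing (Suc (Suc (Suc n))) {Suc n} =
    count_missing (Suc (Suc n)) {Suc n} + count_missing n {n - 1}"
proof -
  have "count_missing (Suc (Suc (Suc n))) {Suc n} =
      count_missing (Suc (Suc n)) {Suc n} +
      count_missing (Suc (Suc n)) {Suc (Suc n), Suc n, n - 1}"
    by (simp add: count_missing_Suc[of "Suc (Suc n)"] insert_commute)
  then show ?thesis
    by simp
qed

lemma count_missing_third_last_recurrence:
  "count_missing (n + 5) {n + 3} =
    S (n + 2) + count_missing (n + 2) {n} + S n + count_missing n {n - 2}"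
  using count_missing_third_last[of "n + 2"] count_missing_second_last[of "n + 2"]
    count_missing_second_last[of n]
  by (simp add: eval_nat_numeral)

section \<open>The generating function\<close>

unbundle fps_syntax

unbundle fps_syntax

theorem proposition9:
  shows "(Abs_fps (\<lambda>n. of_nat (S n)) :: rat fps) =
    (1 + fps_X + fps_X ^ 2 + fps_X ^ 3 + 2 * fps_X ^ 4 + fps_X ^ 6) /
    (1 - fps_X - fps_X ^ 3 + fps_X ^ 4 - 2 * fps_X ^ 5 + fps_X ^ 6 - fps_X ^ 7)"
proof -
  define d where "d n = count_missing n {n - 2}" for n
  define A :: "rat fps" where "A = Abs_fps (\<lambda>n. of_nat (S n))"
  define D :: "rat fps" where "D = Abs_fps (\<lambda>n. of_nat (d n))"
  let ?X = "fps_X :: rat fps"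
  let ?P = "1 + ?X + ?X ^ 2 + ?X ^ 3 + 2 * ?X ^ 4 + ?X ^ 6"
  let ?Q = "1 - ?X - ?X ^ 3 + ?X ^ 4 - 2 * ?X ^ 5 + ?X ^ 6 - ?X ^ 7"
  have S_init: "S 0 = 1" "S (Suc 0) = 2"
    by (simp_all add: S_eq_count_missing count_missing_Suc)
  have d_init: "d 0 = 1" "d 1 = 2" "d 2 = 3" "d 3 = 3" "d 4 = 6"
    by (simp_all add: d_def eval_nat_numeral count_missing_Suc)
  have d_rec: "d (k + 5) = S (k + 2) + d (k + 2) + S k + d k" for k
    using count_missing_third_last_recurrence[of k] by (simp add: d_def add.commute)
  have A_eq: "A = 1 + ?X + ?X * A + ?X ^ 2 * D"
  proof (rule fps_ext)
    fix n
    consider "n = 0" | "n = 1" | k where "n = Suc (Suc k)"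
      by (metis One_nat_def not0_implies_Suc)
    then show "A $ n = (1 + ?X + ?X * A + ?X ^ 2 * D) $ n"
      by cases (simp_all add: A_def D_def S_init fps_X_power_mult_nth S_Suc_Suc d_def)
  qed
  (* The polynomial collects what the recurrence misses below index 5, where one or both
     of the shifted terms vanish. *)
  have D_eq: "D = 1 + 2 * ?X + 3 * ?X ^ 2 + ?X ^ 3 + 2 * ?X ^ 4 + (?X ^ 3 + ?X ^ 5) * (A + D)"
    (is "_ = ?R")
  proof (rule fps_ext)
    fix n
    have coeff: "?R $ n = (1 + 2 * ?X + 3 * ?X ^ 2 + ?X ^ 3 + 2 * ?X ^ 4) $ n
        + (if n < 3 then 0 else (A + D) $ (n - 3)) + (if n < 5 then 0 else (A + D) $ (n - 5))"
      by (simp only: distrib_right fps_add_nth fps_X_power_mult_nth add.assoc)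
    have "n = 0 \<or> n = 1 \<or> n = 2 \<or> n = 3 \<or> n = 4 \<or> n = (n - 5) + 5"
      by linarith
    then consider "n = 0" | "n = 1" | "n = 2" | "n = 3" | "n = 4" | k where "n = k + 5"
      by blast
    then show "D $ n = ?R $ n"
      unfolding coeff
      by cases (simp_all add: A_def D_def S_init d_init[simplified] d_rec fps_numeral_fps_const)
  qed
  have A_lin: "(1 - ?X) * A = 1 + ?X + ?X ^ 2 * D"
    using A_eq by (simp add: algebra_simps)
  have D_lin: "(1 - ?X ^ 3 - ?X ^ 5) * D - (?X ^ 3 + ?X ^ 5) * A =
      1 + 2 * ?X + 3 * ?X ^ 2 + ?X ^ 3 + 2 * ?X ^ 4"
    using D_eq by (simp add: algebra_simps)
  (* Elimination of D by Cramer's rule: ?Q is the determinant of the two linear equations. *)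
  have "A * ?Q = (1 - ?X ^ 3 - ?X ^ 5) * ((1 - ?X) * A) - ?X ^ 2 * ((?X ^ 3 + ?X ^ 5) * A)"
    by (simp add: algebra_simps eval_nat_numeral)
  also have "\<dots> = (1 - ?X ^ 3 - ?X ^ 5) * (1 + ?X)
      + ?X ^ 2 * ((1 - ?X ^ 3 - ?X ^ 5) * D - (?X ^ 3 + ?X ^ 5) * A)"
    unfolding A_lin by (simp add: algebra_simps)
  also have "\<dots> = ?P"
    unfolding D_lin by (simp add: algebra_simps eval_nat_numeral)
  finally have "A * ?Q = ?P" .
  moreover have "?Q \<noteq> 0"
  proof
    assume "?Q = 0"
    then have "?Q $ 0 = 0" by simp
    then show False by (simp add: fps_numeral_fps_const)
  qed
  ultimately have "A = ?P / ?Q"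
    by (metis nonzero_mult_div_cancel_right)
  then show ?thesis
    by (simp add: A_def)
qed

end
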